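(* Let $\mathcal{A}$ be an alphabet with at least two letters and let $p,q$ be primitive words over $\mathcal{A}$. Then the following statements are equivalent. (1) $|p|=2|q|$ and $pq$ is not primitive. (2) Exactly one of the following (mutually exclusive) properties holds: (i) $p=xqx$ for some nonempty word $x$ such that $xq$ is primitive and $|q|=2|x|$; (ii) there exist nonempty words $\alpha,\beta$ and an integer $s\geq 1$ such that $\alpha\beta$ is primitive, $p=(\beta\alpha)^{2s}\beta$, $q=(\alpha\beta)^s\alpha$ and $|\beta|=2|\alpha|$; (iii) there exist nonempty words $\alpha,\beta$ and an integer $s\geq 1$ such that $\alpha\beta$ is primitive, $p=(\beta\alpha)^{2s+1}\beta$, $q=(\alpha\beta)^s\alpha$ and $|\alpha|=2|\beta|$.
   Context: A word over $\mathcal{A}$ is a finite sequence of letters; $|u|$ denotes the length of $u$ and juxtaposition denotes concatenation. A nonempty word $u$ is primitive if $u=v^m$ for a word $v$ and positive integer $m$ implies $m=1$. *)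

theory Defs
  imports Main
begin

text \<open>Words over an alphabet \<open>A\<close> are the elements of \<open>lists A\<close>.\<close>

definition word_power :: "'a list \<Rightarrow> nat \<Rightarrow> 'a list"  (infixr "\<up>" 80)
  where "u \<up> m = concat (replicate m u)"

text \<open>The base \<open>v\<close> ranges over all lists of the letter type: if \<open>m > 0\<close> and \<open>u = v \<up> m\<close>,
  then \<open>v\<close> uses only letters of \<open>u\<close>, so no alphabet parameter is needed.\<close>

definition primitive :: "'a list \<Rightarrow> bool"
  where "primitive u \<longleftrightarrow> u \<noteq> [] \<and> (\<forall>v m. m > 0 \<and> u = v \<up> m \<longrightarrow> m = 1)"

definition form_i :: "'a set \<Rightarrow> 'a list \<Rightarrow> 'a list \<Rightarrow> bool"
  where "form_i A p q \<longleftrightarrow>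
    (\<exists>x \<in> lists A. x \<noteq> [] \<and> p = x @ q @ x \<and> primitive (x @ q) \<and> length q = 2 * length x)"

definition form_ii :: "'a set \<Rightarrow> 'a list \<Rightarrow> 'a list \<Rightarrow> bool"
  where "form_ii A p q \<longleftrightarrow>
    (\<exists>\<alpha> \<in> lists A. \<exists>\<beta> \<in> lists A. \<exists>s::nat. \<alpha> \<noteq> [] \<and> \<beta> \<noteq> [] \<and> s \<ge> 1 \<and> primitive (\<alpha> @ \<beta>) \<and>
      p = (\<beta> @ \<alpha>) \<up> (2 * s) @ \<beta> \<and> q = (\<alpha> @ \<beta>) \<up> s @ \<alpha> \<and> length \<beta> = 2 * length \<alpha>)"

definition form_iii :: "'a set \<Rightarrow> 'a list \<Rightarrow> 'a list \<Rightarrow> bool"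
  where "form_iii A p q \<longleftrightarrow>
    (\<exists>\<alpha> \<in> lists A. \<exists>\<beta> \<in> lists A. \<exists>s::nat. \<alpha> \<noteq> [] \<and> \<beta> \<noteq> [] \<and> s \<ge> 1 \<and> primitive (\<alpha> @ \<beta>) \<and>
      p = (\<beta> @ \<alpha>) \<up> (2 * s + 1) @ \<beta> \<and> q = (\<alpha> @ \<beta>) \<up> s @ \<alpha> \<and> length \<alpha> = 2 * length \<beta>)"

definition exactly_one :: "bool \<Rightarrow> bool \<Rightarrow> bool \<Rightarrow> bool"
  where "exactly_one P Q R \<longleftrightarrow>
    (P \<and> \<not> Q \<and> \<not> R) \<or> (\<not> P \<and> Q \<and> \<not> R) \<or> (\<not> P \<and> \<not> Q \<and> R)"

end

(* Write p @ q = w \<up> k with w primitive. If |p| = 2|q|, then cutting w \<up> k at two thirds of its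
   length either cuts between two copies of w (3 divides k, which primitivity of p excludes) or
   cuts a copy of w at a third or two thirds of its length. The cases k = 2, k = 3s + 1 and
   k = 3s + 2 with s \<ge> 1 are (i), (ii) and (iii); they exclude each other since w, hence k,
   is determined by p @ q. *)
theory Submission
  imports Defs
begin

section \<open>Powers of words\<close>

lemma word_power_0 [simp]: "u \<up> 0 = []"
  by (simp add: word_power_def)

lemma word_power_Suc [simp]: "u \<up> Suc n = u @ u \<up> n"
  by (simp add: word_power_def)

lemma word_power_add: "u \<up> (m + n) = u \<up> m @ u \<up> n"
  by (simp add: word_power_def replicate_add)

lemma word_power_mult: "(u \<up> m) \<up> n = u \<up> (m * n)"
  by (induction n) (simp_all add: word_power_add)

lemma length_word_power [simp]: "length (u \<up> n) = n * length u"
  by (induction n) simp_all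

text \<open>This regrouping trades powers of \<open>u @ v\<close> for powers of the conjugate
  \<open>v @ u\<close>; it is what later merges \<open>p\<close> and \<open>q\<close> into one
  power.\<close>

lemma word_power_shift: "u @ (v @ u) \<up> n = (u @ v) \<up> n @ u"
  by (induction n) simp_all

lemma word_power_commute: "u @ u \<up> n = u \<up> n @ u"
  using word_power_shift[of u "[]" n] by simp

lemma rotate1_word_power: "rotate1 (v \<up> m) = (rotate1 v) \<up> m"
proof (cases v)
  case Nil
  then show ?thesis by (induction m) simp_all
next
  case (Cons x xs)
  then show ?thesis
    \<comment> \<open>For \<open>m = Suc n\<close> the first letter \<open>x\<close> moves to the
      end, and the shift lemma pulls it back through the remaining \<open>n\<close> copies.\<close>
    using word_power_shift[of "[x]" xs] by (cases m) simp_all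
qed

lemma rotate_word_power: "rotate n (v \<up> m) = (rotate n v) \<up> m"
  by (induction n) (simp_all add: rotate1_word_power)

section \<open>Primitive words and primitive roots\<close>

lemma primitiveD: "primitive u \<Longrightarrow> u = v \<up> m \<Longrightarrow> m = 1"
  by (cases "m = 0") (auto simp: primitive_def)

text \<open>Rotation by \<open>length v\<close> carries \<open>v @ u\<close> to \<open>u @ v\<close>
  and commutes with powers, so it preserves the exponent of any power decomposition.\<close>

lemma primitive_conjugate:
  assumes "primitive (u @ v)"
  shows "primitive (v @ u)"
  unfolding primitive_def
proof (intro conjI allI impI)
  show "v @ u \<noteq> []" using assms by (auto simp: primitive_def)
next
  fix w m assume "0 < m \<and> v @ u = w \<up> m"
  then have "u @ v = (rotate (length v) w) \<up> m"
    by (metis rotate_append rotate_word_power)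
  then show "m = 1" by (rule primitiveD[OF assms])
qed

text \<open>A nonprimitive word is a power, with exponent above 1, of a shorter nonempty word, and a
  root of that word is also a root of the given one.\<close>

lemma primitive_root_exists:
  assumes "u \<noteq> []"
  obtains w k where "primitive w" "u = w \<up> k"
  using assms
proof (induction "length u" arbitrary: u thesis rule: less_induct)
  case less
  show ?case
  proof (cases "primitive u")
    case True
    then show ?thesis using less.prems(1)[of u 1] by simp
  next
    case False
    then obtain v m where m: "m > 0" "m \<noteq> 1" "u = v \<up> m"
      using less.prems(2) unfolding primitive_def by auto
    have "v \<noteq> []" using m(3) less.prems(2) by (metis length_0_conv length_word_power mult_0_right)
    then have "length v < length u" using m by simp
    then obtain w k where "primitive w" "v = w \<up> k"
      using less.hyps \<open>v \<noteq> []\<close> by metis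
    then show ?thesis using less.prems(1) m(3) word_power_mult by metis
  qed
qed

text \<open>Both \<open>u @ v\<close> and \<open>v @ u\<close> are prefixes of \<open>w @ w\<close> for the common power \<open>w\<close>.\<close>

lemma word_power_eq_commute:
  assumes "u \<up> a = v \<up> b" "a > 0" "b > 0"
  shows "u @ v = v @ u"
proof -
  define w where "w = u \<up> a"
  have u: "u @ w = w @ u" by (simp add: w_def word_power_commute)
  have v: "v @ w = w @ v" by (simp add: w_def assms(1) word_power_commute)
  \<comment> \<open>Positive exponents keep the prefix of length \<open>length u + length v\<close>
    inside \<open>w @ w\<close>.\<close>
  have len: "length u \<le> length w" "length v \<le> length w"
    using assms(2,3) by (simp add: w_def, simp add: w_def assms(1))
  have pre: "x @ y = take (length x + length y) (w @ w)"
    if "x @ w = w @ x" "y @ w = w @ y" "length x \<le> length w" "length y \<le> length w" for x y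
  proof -
    have "(x @ y) @ w @ w = (w @ w) @ x @ y"
      using that by (metis append.assoc)
    then have "take (length (x @ y)) ((x @ y) @ w @ w) = take (length (x @ y)) ((w @ w) @ x @ y)"
      by simp
    then show ?thesis using that by simp
  qed
  show ?thesis
    using pre[OF u v len] pre[OF v u len(2,1)] by (simp add: add.commute)
qed

text \<open>Equal powers make \<open>u\<close> and \<open>v\<close> commute, so both are powers of a
  common word \<open>z\<close>; primitivity forces both exponents to be 1. Lengths then give
  \<open>a = b\<close>.\<close>

lemma primitive_root_unique:
  assumes "primitive u" "primitive v" "u \<up> a = v \<up> b" "a > 0"
  shows "u = v" "a = b"
proof -
  have ne: "u \<noteq> []" "v \<noteq> []" using assms(1,2) by (auto simp: primitive_def)
  have len: "a * length u = b * length v"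
    using assms(3) by (metis length_word_power)
  then have "b > 0" using ne assms(4) by (cases b) auto
  then obtain m n z where "z \<up> m = u" "z \<up> n = v"
    using comm_append_are_replicate[OF word_power_eq_commute[OF assms(3,4)]]
    unfolding word_power_def by blast
  then show uv: "u = v" using assms(1,2) primitiveD by metis
  show "a = b" using len ne uv by simp
qed

section \<open>Exponent of \<open>p @ q\<close> in each form\<close>

text \<open>Here \<open>p @ q\<close> is the square of \<open>x @ q\<close>.\<close>

lemma form_i_exponent:
  assumes "form_i A p q"
  shows "length p = 2 * length q \<and> (\<exists>w. primitive w \<and> p @ q = w \<up> 2)"
  using assms unfolding form_i_def by (force simp: numeral_2_eq_2)

text \<open>The trailing \<beta> of \<open>p\<close> together with \<open>q\<close> makes
  \<open>s + 1\<close> further copies of \<open>\<beta> @ \<alpha>\<close>, a conjugate of the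
  primitive \<open>\<alpha> @ \<beta>\<close>.\<close>

lemma form_ii_exponent:
  assumes "form_ii A p q"
  shows "length p = 2 * length q \<and> (\<exists>w s. s \<ge> 1 \<and> primitive w \<and> p @ q = w \<up> (3 * s + 1))"
proof -
  from assms obtain \<alpha> \<beta> and s :: nat where *: "s \<ge> 1" "primitive (\<alpha> @ \<beta>)"
    "p = (\<beta> @ \<alpha>) \<up> (2 * s) @ \<beta>" "q = (\<alpha> @ \<beta>) \<up> s @ \<alpha>" "length \<beta> = 2 * length \<alpha>"
    unfolding form_ii_def by blast
  have "p @ q = (\<beta> @ \<alpha>) \<up> (2 * s + Suc s)"
    by (simp only: * word_power_add word_power_Suc append.assoc word_power_shift[of \<alpha> \<beta> s, symmetric])
  then have "p @ q = (\<beta> @ \<alpha>) \<up> (3 * s + 1)" by (simp add: numeral_3_eq_3)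
  moreover have "length p = 2 * length q" by (simp add: * algebra_simps)
  ultimately show ?thesis using * primitive_conjugate by blast
qed

lemma form_iii_exponent:
  assumes "form_iii A p q"
  shows "length p = 2 * length q \<and> (\<exists>w s. s \<ge> 1 \<and> primitive w \<and> p @ q = w \<up> (3 * s + 2))"
proof -
  from assms obtain \<alpha> \<beta> and s :: nat where *: "s \<ge> 1" "primitive (\<alpha> @ \<beta>)"
    "p = (\<beta> @ \<alpha>) \<up> (2 * s + 1) @ \<beta>" "q = (\<alpha> @ \<beta>) \<up> s @ \<alpha>" "length \<alpha> = 2 * length \<beta>"
    unfolding form_iii_def by blast
  have "p @ q = (\<beta> @ \<alpha>) \<up> (2 * s + 1 + Suc s)"
    by (simp only: * word_power_add word_power_Suc append.assoc word_power_shift[of \<alpha> \<beta> s, symmetric])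
  moreover have "2 * s + 1 + Suc s = 3 * s + 2" by simp
  ultimately have "p @ q = (\<beta> @ \<alpha>) \<up> (3 * s + 2)" by simp
  moreover have "length p = 2 * length q" by (simp add: * algebra_simps)
  ultimately show ?thesis using * primitive_conjugate by blast
qed

lemma forms_exclusive:
  shows "\<not> (form_i A p q \<and> form_ii A p q)"
    and "\<not> (form_i A p q \<and> form_iii A p q)"
    and "\<not> (form_ii A p q \<and> form_iii A p q)"
proof -
  have uniq: "k = l" if "primitive u" "primitive v" "p @ q = u \<up> k" "p @ q = v \<up> l" "k > 0"
    for u v k l using primitive_root_unique(2) that by metis
  show "\<not> (form_i A p q \<and> form_ii A p q)"
  proof
    assume "form_i A p q \<and> form_ii A p q"
    then obtain u v s where "s \<ge> 1" "primitive u" "primitive v"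
      "p @ q = u \<up> 2" "p @ q = v \<up> (3 * s + 1)"
      using form_i_exponent form_ii_exponent by meson
    then have "2 = 3 * s + 1" by (intro uniq[of u v]) (assumption | simp)+
    then show False by presburger
  qed
  show "\<not> (form_i A p q \<and> form_iii A p q)"
  proof
    assume "form_i A p q \<and> form_iii A p q"
    then obtain u v s where "s \<ge> 1" "primitive u" "primitive v"
      "p @ q = u \<up> 2" "p @ q = v \<up> (3 * s + 2)"
      using form_i_exponent form_iii_exponent by meson
    then have "2 = 3 * s + 2" by (intro uniq[of u v]) (assumption | simp)+
    \<comment> \<open>For \<open>s = 0\<close> both exponents would be 2; the other two clashes are
      impossible modulo 3.\<close>
    then show False using \<open>s \<ge> 1\<close> by simp
  qed
  show "\<not> (form_ii A p q \<and> form_iii A p q)"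
  proof
    assume "form_ii A p q \<and> form_iii A p q"
    then obtain u v s t where "primitive u" "primitive v"
      "p @ q = u \<up> (3 * s + 1)" "p @ q = v \<up> (3 * t + 2)"
      using form_ii_exponent form_iii_exponent by meson
    then have "3 * s + 1 = 3 * t + 2" by (intro uniq[of u v]) (assumption | simp)+
    then show False by presburger
  qed
qed

text \<open>The exponents 2, \<open>3 * s + 1\<close> and \<open>3 * s + 2\<close> with
  \<open>s \<ge> 1\<close> all differ from 1.\<close>

lemma forms_imp_not_primitive:
  assumes "form_i A p q \<or> form_ii A p q \<or> form_iii A p q"
  shows "length p = 2 * length q \<and> \<not> primitive (p @ q)"
proof -
  obtain w k where "length p = 2 * length q" "p @ q = w \<up> k" "k \<noteq> 1"
    using assms
  proof (elim disjE)
    assume "form_i A p q"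
    then show ?thesis using form_i_exponent that[of _ 2] by fastforce
  next
    assume "form_ii A p q"
    then obtain w s where "s \<ge> 1" "length p = 2 * length q" "p @ q = w \<up> (3 * s + 1)"
      using form_ii_exponent by meson
    then show ?thesis using that[of w "3 * s + 1"] by simp
  next
    assume "form_iii A p q"
    then obtain w s where "s \<ge> 1" "length p = 2 * length q" "p @ q = w \<up> (3 * s + 2)"
      using form_iii_exponent by meson
    then show ?thesis using that[of w "3 * s + 2"] by simp
  qed
  then show ?thesis using primitiveD by metis
qed

section \<open>Cutting a power at two thirds of its length\<close>

text \<open>The length hypothesis puts the cut right after the \<beta> of copy number
  \<open>m + 1\<close>; two factorizations of one word whose first factors have equal length
  coincide.\<close>

lemma split_word_power:
  assumes "p @ q = (\<beta> @ \<alpha>) \<up> (m + Suc s)"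
    and "length p = m * length (\<beta> @ \<alpha>) + length \<beta>"
  shows "p = (\<beta> @ \<alpha>) \<up> m @ \<beta>" "q = (\<alpha> @ \<beta>) \<up> s @ \<alpha>"
proof -
  have "p @ q = ((\<beta> @ \<alpha>) \<up> m @ \<beta>) @ (\<alpha> @ \<beta>) \<up> s @ \<alpha>"
    by (simp only: assms(1) word_power_add word_power_Suc append.assoc
        word_power_shift[of \<alpha> \<beta> s, symmetric])
  moreover have "length p = length ((\<beta> @ \<alpha>) \<up> m @ \<beta>)"
    using assms(2) by simp
  ultimately show "p = (\<beta> @ \<alpha>) \<up> m @ \<beta>" "q = (\<alpha> @ \<beta>) \<up> s @ \<alpha>"
    by (simp_all only: append_eq_append_conv simp_thms)
qed

lemma not_primitive_imp_forms:
  assumes "p \<in> lists A" "q \<in> lists A" "primitive p"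
    and len: "length p = 2 * length q" and np: "\<not> primitive (p @ q)"
  shows "form_i A p q \<or> form_ii A p q \<or> form_iii A p q"
proof -
  have "p \<noteq> []" using assms(3) by (simp add: primitive_def)
  then obtain w k where w: "primitive w" "p @ q = w \<up> k"
    using primitive_root_exists[of "p @ q"] by blast
  have wne: "w \<noteq> []" using w(1) by (simp add: primitive_def)
  have k1: "k \<noteq> 1" using np w by auto
  have k0: "k \<noteq> 0" using w(2) \<open>p \<noteq> []\<close> by (cases k) auto
  have wA: "w \<in> lists A"
  proof -
    have "w @ w \<up> (k - 1) = p @ q" using w(2) k0 by (cases k) auto
    then show ?thesis using assms(1,2) by (metis append_in_lists_conv)
  qed
  define s where "s = k div 3"
  have total: "3 * length q = k * length w"
    using arg_cong[OF w(2), of length] len by simp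
  consider (0) "k = 3 * s" | (1) "k = 3 * s + 1" | (2) "k = 3 * s + 2"
    unfolding s_def by linarith
  then show ?thesis
  proof cases
    case 0
    have "p @ q = w \<up> (2 * s) @ w \<up> s"
      using w(2) 0 by (simp flip: word_power_add)
    moreover have "length p = length (w \<up> (2 * s))" using total 0 len by simp
    ultimately have "p = w \<up> (2 * s)" by simp
    \<comment> \<open>Primitivity of \<open>p\<close> would make an even exponent equal to
      1.\<close>
    then have "2 * s = 1" by (rule primitiveD[OF assms(3)])
    then show ?thesis by presburger
  next
    case 1
    \<comment> \<open>Naming the product \<open>s * length w\<close> makes the divisibility argument
      linear.\<close>
    define c where "c = s * length w"
    have "3 * length q = 3 * c + length w"
      using total 1 by (simp add: c_def algebra_simps)
    then have "\<exists>l. length w = 3 * l \<and> length q = c + l" by presburger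
    then obtain l where l: "length w = 3 * l" "length q = s * length w + l"
      unfolding c_def by blast
    \<comment> \<open>Doubling \<open>length q\<close> gives
      \<open>length p = 2 * s * length w + 2 * l\<close>, so the cut falls two thirds into a copy of
      \<open>w\<close>.\<close>
    define \<alpha> \<beta> where "\<alpha> = drop (2 * l) w" and "\<beta> = take (2 * l) w"
    have ba: "w = \<beta> @ \<alpha>" and la: "length \<alpha> = l" "length \<beta> = 2 * l"
      using l by (simp_all add: \<alpha>_def \<beta>_def)
    have "p @ q = (\<beta> @ \<alpha>) \<up> (2 * s + Suc s)" using w(2) 1 ba by (simp add: mult.commute)
    moreover have "length p = 2 * s * length (\<beta> @ \<alpha>) + length \<beta>"
      using len l la ba by simp
    ultimately have "p = (\<beta> @ \<alpha>) \<up> (2 * s) @ \<beta>" "q = (\<alpha> @ \<beta>) \<up> s @ \<alpha>"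
      by (rule split_word_power)+
    moreover have "s \<ge> 1" using k1 1 by simp
    moreover have "\<alpha> \<in> lists A" "\<beta> \<in> lists A" using wA ba by auto
    moreover have "\<alpha> \<noteq> []" "\<beta> \<noteq> []" using la l wne by auto
    moreover have "primitive (\<alpha> @ \<beta>)" using w(1) ba primitive_conjugate by blast
    ultimately have "form_ii A p q" unfolding form_ii_def using la by auto
    then show ?thesis by simp
  next
    case 2
    define c where "c = s * length w"
    have "3 * length q = 3 * c + 2 * length w"
      using total 2 by (simp add: c_def algebra_simps)
    then have "\<exists>l. length w = 3 * l \<and> length q = c + 2 * l" by presburger
    then obtain l where l: "length w = 3 * l" "length q = s * length w + 2 * l"
      unfolding c_def by blast
    \<comment> \<open>Now \<open>length p = 2 * s * length w + 4 * l\<close>. Since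
      \<open>4 * l = length w + l\<close>, one more full copy fits and the cut falls one third into
      the next.\<close>
    define \<alpha> \<beta> where "\<alpha> = drop l w" and "\<beta> = take l w"
    have ba: "w = \<beta> @ \<alpha>" and la: "length \<alpha> = 2 * l" "length \<beta> = l"
      using l by (simp_all add: \<alpha>_def \<beta>_def)
    have "2 * s + 1 + Suc s = k" using 2 by simp
    then have "p @ q = (\<beta> @ \<alpha>) \<up> (2 * s + 1 + Suc s)" using w(2) ba by simp
    moreover have "length p = (2 * s + 1) * length (\<beta> @ \<alpha>) + length \<beta>"
      using len l la ba by simp
    ultimately have pq: "p = (\<beta> @ \<alpha>) \<up> (2 * s + 1) @ \<beta>" "q = (\<alpha> @ \<beta>) \<up> s @ \<alpha>"
      by (rule split_word_power)+
    have A: "\<alpha> \<in> lists A" "\<beta> \<in> lists A" using wA ba by auto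
    have ne: "\<alpha> \<noteq> []" "\<beta> \<noteq> []" using la l wne by auto
    have prim: "primitive (\<alpha> @ \<beta>)" using w(1) ba primitive_conjugate by blast
    show ?thesis
    \<comment> \<open>For \<open>s = 0\<close> the split reads
      \<open>p = \<beta> @ \<alpha> @ \<beta>\<close> and \<open>q = \<alpha>\<close>, which is form
      (i) with \<open>x = \<beta>\<close> and \<open>x @ q = w\<close>.\<close>
    proof (cases "s = 0")
      case True
      then have "form_i A p q"
        unfolding form_i_def using pq A ne la w(1) ba by (intro bexI[of _ \<beta>]) auto
      then show ?thesis by simp
    next
      case False
      then have "s \<ge> 1" by simp
      then have "form_iii A p q"
        unfolding form_iii_def using pq A ne prim la by auto
      then show ?thesis by simp
    qed
  qed
qed

theorem theorem3p3:
  fixes A :: "'a set" and p q :: "'a list"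
  assumes "\<exists>a \<in> A. \<exists>b \<in> A. a \<noteq> b"
    and "p \<in> lists A" and "q \<in> lists A"
    and "primitive p" and "primitive q"
  shows "(length p = 2 * length q \<and> \<not> primitive (p @ q) \<longleftrightarrow>
          exactly_one (form_i A p q) (form_ii A p q) (form_iii A p q))
    \<and> \<not> (form_i A p q \<and> form_ii A p q)
    \<and> \<not> (form_i A p q \<and> form_iii A p q)
    \<and> \<not> (form_ii A p q \<and> form_iii A p q)"
  \<comment> \<open>Pairwise exclusion sharpens "at least one form" to "exactly one".\<close>
  using not_primitive_imp_forms[OF assms(2-4)] forms_imp_not_primitive[of A p q]
    forms_exclusive[of A p q]
  unfolding exactly_one_def by blast

end
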